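(* Let $r$ be a positive integer and $t\geq 2$ an integer. Let \[n_1=(6(t-1)-1)r+2,\qquad n_2=2(t-1)\binom{6(t-1)}{2}+3(t-1)(r+1)+1.\] Then every coloring of the edges of the complete bipartite graph $K_{n_1,n_2}$ with $r$ colors contains a monochromatic copy of $K_{2,t}$ or a rainbow copy of $K_{2,t}$.
   Context: A subgraph is monochromatic if all its edges have the same color, and rainbow if all its edges have pairwise distinct colors. *)

theory Defs
  imports "Graph_Theory.Kuratowski" "HOL-Library.FuncSet"
begin

text \<open>
  In Graph_Theory an undirected simple graph is a symmetric digraph, with two opposite arcs for
  each edge. Colorings are functions on the undirected edges, viewed as two-element vertex sets,
  so that opposite arcs carry the same color and count as one edge.
\<close>

definition undirected_edges :: "('a, 'b) pre_digraph \<Rightarrow> 'a set set" where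
  "undirected_edges G = {{u, v} | u v. (u, v) \<in> arcs_ends G}"

definition monochromatic :: "('a set \<Rightarrow> 'c) \<Rightarrow> ('a, 'b) pre_digraph \<Rightarrow> bool" where
  "monochromatic c H \<longleftrightarrow>
     (\<forall>e \<in> undirected_edges H. \<forall>e' \<in> undirected_edges H. c e = c e')"

definition rainbow :: "('a set \<Rightarrow> 'c) \<Rightarrow> ('a, 'b) pre_digraph \<Rightarrow> bool" where
  "rainbow c H \<longleftrightarrow>
     (\<forall>e \<in> undirected_edges H. \<forall>e' \<in> undirected_edges H. e \<noteq> e' \<longrightarrow> c e \<noteq> c e')"

end

theory Submission
  imports Defs
begin

text \<open>
  Put \<open>s = t - 1\<close> and suppose there is no monochromatic copy with two vertices in \<open>U\<close> and \<open>t\<close>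
  in \<open>V\<close>, where \<open>U\<close> and \<open>V\<close> are the parts of sizes \<open>n1\<close> and \<open>n2\<close>. Call \<open>u \<in> U\<close> popular in color \<open>j\<close> if more than \<open>m\<close> edges at \<open>u\<close> have color \<open>j\<close>,
  where \<open>m\<close> is about half of \<open>(6s choose 2) + r\<close>. The color-\<open>j\<close> neighborhoods of two vertices of
  \<open>U\<close> share at most \<open>s\<close> vertices, so by Bonferroni's inequality \<open>6s\<close> vertices popular in the same
  color would need more than \<open>n2\<close> neighbors. Hence at most \<open>(6s - 1) r\<close> vertices of \<open>U\<close> are popular,
  and two vertices \<open>u, u'\<close> are unpopular in every color. Their edges to \<open>v\<close> have the same color for
  at most \<open>r s\<close> vertices \<open>v\<close>; among the others each chosen \<open>v\<close> rules out at most \<open>4 m\<close> vertices, so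
  greedily \<open>t\<close> vertices can be chosen that form a rainbow copy with \<open>u, u'\<close>.
\<close>

text \<open>Induction on \<open>A\<close>: the set of a new index overlaps the union of the earlier
  ones in at most \<open>s\<close> points for each earlier index, and \<open>s * card A\<close> is
  exactly how much the pair term grows.\<close>

lemma sum_card_le_card_Union_plus_pairs:
  fixes W :: "'a \<Rightarrow> 'b set"
  assumes "finite A" and "\<And>a. a \<in> A \<Longrightarrow> finite (W a)"
    and "\<And>a b. a \<in> A \<Longrightarrow> b \<in> A \<Longrightarrow> a \<noteq> b \<Longrightarrow> card (W a \<inter> W b) \<le> s"
  shows "(\<Sum>a\<in>A. card (W a)) \<le> card (\<Union>a\<in>A. W a) + s * (card A choose 2)"
  using assms
proof (induction A rule: finite_induct)
  case empty
  then show ?case by simp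
next
  case (insert x A)
  let ?R = "\<Union>a\<in>A. W a"
  have "card (W x \<inter> ?R) = card (\<Union>a\<in>A. W x \<inter> W a)"
    by (simp only: Int_UN_distrib)
  also have "\<dots> \<le> (\<Sum>a\<in>A. card (W x \<inter> W a))"
    by (rule card_UN_le) fact
  also have "\<dots> \<le> (\<Sum>a\<in>A. s)"
    using insert by (intro sum_mono) auto
  finally have inter: "card (W x \<inter> ?R) \<le> s * card A"
    by (simp add: mult.commute)
  have "card (W x) + card ?R = card (W x \<union> ?R) + card (W x \<inter> ?R)"
    using insert by (intro card_Un_Int) auto
  moreover have "(\<Sum>a\<in>A. card (W a)) \<le> card ?R + s * (card A choose 2)"
    using insert by auto
  moreover have "Suc (card A) choose 2 = card A + (card A choose 2)"
    by (simp add: numeral_2_eq_2)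
  ultimately show ?case
    using insert inter by (simp add: distrib_left)
qed

lemma card_le_fibers:
  assumes "finite A" and "finite J" and "\<And>x. x \<in> A \<Longrightarrow> f x \<in> J"
    and "\<And>j. j \<in> J \<Longrightarrow> card {x \<in> A. f x = j} \<le> k"
  shows "card A \<le> card J * k"
proof -
  have "A = (\<Union>j\<in>J. {x \<in> A. f x = j})"
    using assms(3) by auto
  then have "card A \<le> (\<Sum>j\<in>J. card {x \<in> A. f x = j})"
    using card_UN_le[OF assms(2), of "\<lambda>j. {x \<in> A. f x = j}"] by simp
  also have "\<dots> \<le> (\<Sum>j\<in>J. k)"
    using assms(4) by (rule sum_mono)
  finally show ?thesis by simp
qed

text \<open>Greedy choice: a further vertex must avoid, under both \<open>f\<close> and
  \<open>g\<close>, every color already used. With \<open>f\<close> and \<open>g\<close> the colors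
  at two fixed vertices, \<open>S\<close> completes a rainbow copy.\<close>

lemma rainbow_selection:
  fixes f g :: "'v \<Rightarrow> 'c"
  assumes "finite D" and ne: "\<And>v. v \<in> D \<Longrightarrow> f v \<noteq> g v"
    and f: "\<And>j. card {v \<in> D. f v = j} \<le> m" and g: "\<And>j. card {v \<in> D. g v = j} \<le> m"
    and "4 * m * (n - 1) < card D"
  shows "\<exists>S\<subseteq>D. card S = n \<and> inj_on f S \<and> inj_on g S \<and> f ` S \<inter> g ` S = {}"
  using assms(5)
proof (induction n)
  case 0
  then show ?case by (intro exI[of _ "{}"]) simp
next
  case (Suc n)
  have "4 * m * (n - 1) \<le> 4 * m * n"
    by (intro mult_left_mono) auto
  also have "\<dots> < card D" using Suc.prems by simp
  finally obtain S where S: "S \<subseteq> D" "card S = n" "inj_on f S" "inj_on g S" "f ` S \<inter> g ` S = {}"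
    using Suc.IH by blast
  let ?J = "f ` S \<union> g ` S"
  have fin: "finite S" using S(1) \<open>finite D\<close> by (rule finite_subset)
  have "card ?J \<le> 2 * n"
    using card_Un_le[of "f ` S" "g ` S"] card_image_le[OF fin, of f] card_image_le[OF fin, of g] S(2)
    by linarith
  moreover have "card {v \<in> D. f v \<in> ?J} \<le> card ?J * m"
    by (rule card_le_fibers[where f = f])
      (use fin \<open>finite D\<close> in \<open>auto intro!: order_trans[OF card_mono f]\<close>)
  moreover have "card {v \<in> D. g v \<in> ?J} \<le> card ?J * m"
    by (rule card_le_fibers[where f = g])
      (use fin \<open>finite D\<close> in \<open>auto intro!: order_trans[OF card_mono g]\<close>)
  \<comment> \<open>The \<open>n\<close> chosen vertices use at most \<open>2 * n\<close> colors.
    Each color excludes at most \<open>m\<close> vertices through \<open>f\<close> and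
    \<open>m\<close> through \<open>g\<close>, whence the factor 4.\<close>
  ultimately have "card ({v \<in> D. f v \<in> ?J} \<union> {v \<in> D. g v \<in> ?J}) \<le> 2 * n * m + 2 * n * m"
    by (meson add_mono card_Un_le le_trans mult_le_mono1)
  also have "\<dots> < card D" using Suc.prems by (simp add: mult.commute mult.left_commute)
  finally have "D \<noteq> {v \<in> D. f v \<in> ?J} \<union> {v \<in> D. g v \<in> ?J}"
    by force
  then obtain v where v: "v \<in> D" "f v \<notin> ?J" "g v \<notin> ?J" by blast
  then have "v \<notin> S" by auto
  then show ?case
    using S v fin ne[OF v(1)] by (intro exI[of _ "insert v S"]) auto
qed

text \<open>The combinatorial core, free of the graph encoding: an edge is a pair in
  \<open>U \<times> V\<close>, so a rainbow copy amounts to injectivity on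
  \<open>P \<times> S\<close>.\<close>

lemma monochromatic_or_rainbow_pair:
  fixes f :: "'u \<Rightarrow> 'v \<Rightarrow> nat" and s r :: nat
  assumes "s \<ge> 1" and "finite V"
    and cU: "card U = (6 * s - 1) * r + 2"
    and cV: "card V = 2 * s * ((6 * s) choose 2) + 3 * s * (r + 1) + 1"
    and fr: "\<And>u v. u \<in> U \<Longrightarrow> v \<in> V \<Longrightarrow> f u v \<in> {1..r}"
  shows "\<exists>P S. P \<subseteq> U \<and> S \<subseteq> V \<and> card P = 2 \<and> card S = s + 1 \<and>
    ((\<exists>j. \<forall>u\<in>P. \<forall>v\<in>S. f u v = j) \<or> inj_on (\<lambda>(u, v). f u v) (P \<times> S))"
proof (rule ccontr)
  assume none: "\<not> ?thesis"
  define C where "C = (6 * s) choose 2"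
  \<comment> \<open>The rounding gives \<open>C + r \<le> 2 * m \<le> C + r + 1\<close>: the lower
    bound limits the popular vertices, the upper one leaves room for the greedy choice.\<close>
  define m where "m = (C + r + 1) div 2"
  have finU: "finite U" using cU by (metis card.infinite add_2_eq_Suc' nat.distinct(1))
  have mono: "card {v \<in> V. f a v = j \<and> f b v = j} \<le> s" if "a \<in> U" "b \<in> U" "a \<noteq> b" for a b j
  proof (rule ccontr)
    assume "\<not> ?thesis"
    then obtain S where "S \<subseteq> {v \<in> V. f a v = j \<and> f b v = j}" "card S = s + 1"
      using obtain_subset_with_card_n[of "s + 1" "{v \<in> V. f a v = j \<and> f b v = j}"] by auto
    then have "{a, b} \<subseteq> U \<and> S \<subseteq> V \<and> card {a, b} = 2 \<and> card S = s + 1 \<and>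
        (\<forall>u\<in>{a, b}. \<forall>v\<in>S. f u v = j)"
      using that by auto
    then show False using none by blast
  qed
  let ?W = "\<lambda>j u. {v \<in> V. f u v = j}"
  let ?pop = "\<lambda>j. {u \<in> U. m < card (?W j u)}"
  have pop: "card (?pop j) \<le> 6 * s - 1" for j
  proof (rule ccontr)
    assume "\<not> ?thesis"
    then have "6 * s \<le> card (?pop j)" by linarith
    then obtain A where A: "A \<subseteq> ?pop j" "card A = 6 * s" "finite A"
      using obtain_subset_with_card_n[of "6 * s" "?pop j"] by blast
    have "6 * s * (m + 1) = (\<Sum>a\<in>A. m + 1)" using A by simp
    also have "\<dots> \<le> (\<Sum>a\<in>A. card (?W j a))"
      using A(1) by (intro sum_mono) auto
    also have "\<dots> \<le> card (\<Union>a\<in>A. ?W j a) + s * (card A choose 2)"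
    proof (rule sum_card_le_card_Union_plus_pairs)
      fix a b assume "a \<in> A" "b \<in> A" "a \<noteq> b"
      moreover have "?W j a \<inter> ?W j b = {v \<in> V. f a v = j \<and> f b v = j}" by auto
      ultimately show "card (?W j a \<inter> ?W j b) \<le> s"
        using mono[of a b j] A(1) by auto
    qed (use A \<open>finite V\<close> in auto)
    also have "\<dots> \<le> card V + s * C"
      using A(2) \<open>finite V\<close> by (auto simp: C_def intro!: card_mono)
    finally have "6 * s * (m + 1) \<le> 3 * s * C + 3 * s * (r + 1) + 1"
      using cV by (simp add: C_def)
    moreover have "3 * s * (C + r + 2) \<le> 3 * s * (2 * (m + 1))"
      by (intro mult_left_mono) (auto simp: m_def)
    \<comment> \<open>The two bounds together force \<open>3 * s \<le> 1\<close>.\<close>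
    ultimately show False using \<open>s \<ge> 1\<close> by (simp add: algebra_simps)
  qed
  let ?Q = "U - (\<Union>j\<in>{1..r}. ?pop j)"
  have "card (\<Union>j\<in>{1..r}. ?pop j) \<le> (\<Sum>j\<in>{1..r}. card (?pop j))"
    by (rule card_UN_le) simp
  also have "\<dots> \<le> (\<Sum>j\<in>{1..r}. 6 * s - 1)"
    by (rule sum_mono) (rule pop)
  finally have "card (\<Union>j\<in>{1..r}. ?pop j) \<le> (6 * s - 1) * r" by (simp add: mult.commute)
  \<comment> \<open>The summand 2 in \<open>card U\<close> is what survives the removal of all
    popular vertices.\<close>
  then have "2 \<le> card ?Q"
    using cU diff_card_le_card_Diff[of "\<Union>j\<in>{1..r}. ?pop j" U] finU
    by (auto intro: finite_subset)
  then obtain P where "P \<subseteq> ?Q" "card P = 2" by (meson obtain_subset_with_card_n)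
  then obtain a b where ab: "a \<noteq> b" "a \<in> ?Q" "b \<in> ?Q" by (auto simp: card_2_iff)
  \<comment> \<open>The greedy choice needs the bound for every \<open>j\<close>; colors outside
    \<open>{1..r}\<close> have empty classes.\<close>
  have low: "card (?W j u) \<le> m" if "u \<in> ?Q" for j u
  proof (cases "j \<in> {1..r}")
    case True
    then show ?thesis using that by (blast intro: leI)
  next
    case False
    then have "?W j u = {}" using fr[of u] that by blast
    then show ?thesis by (simp only: card.empty)
  qed
  define E where "E = {v \<in> V. f a v = f b v}"
  define D where "D = V - E"
  have "card E \<le> card {1..r} * s"
  proof (rule card_le_fibers[where f = "f a"])
    fix j
    have "{v \<in> E. f a v = j} = {v \<in> V. f a v = j \<and> f b v = j}" by (auto simp: E_def)
    then show "card {v \<in> E. f a v = j} \<le> s" using mono[of a b j] ab by simp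
  qed (use fr ab \<open>finite V\<close> in \<open>auto simp: E_def\<close>)
  then have E: "card E \<le> r * s" by simp
  have "E \<subseteq> V" by (auto simp: E_def)
  then have cD: "card V = card D + card E"
    unfolding D_def using \<open>finite V\<close> by (metis add.commute card_Diff_subset card_mono
        finite_subset le_add_diff_inverse)
  have "2 * s * (2 * m) \<le> 2 * s * (C + r + 1)"
    by (intro mult_left_mono) (auto simp: m_def)
  \<comment> \<open>Removing \<open>E\<close> costs at most \<open>r * s\<close>, so
    \<open>card D\<close> is at least \<open>2 * s * (C + r + 1) + s + 1\<close>.\<close>
  then have "4 * m * (s + 1 - 1) < card D"
    using cD E cV[folded C_def] \<open>s \<ge> 1\<close> by (simp add: algebra_simps)
  have "card {v \<in> D. f u v = j} \<le> m" if "u \<in> ?Q" for u j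
    by (rule order_trans[OF card_mono low[OF that, of j]]) (use \<open>finite V\<close> in \<open>auto simp: D_def\<close>)
  then have "\<exists>S\<subseteq>D. card S = s + 1 \<and> inj_on (f a) S \<and> inj_on (f b) S \<and> f a ` S \<inter> f b ` S = {}"
    using ab \<open>finite V\<close> \<open>4 * m * (s + 1 - 1) < card D\<close>
    by (intro rainbow_selection[where m = m]) (auto simp: D_def E_def)
  then obtain S where S: "S \<subseteq> D" "card S = s + 1" "inj_on (f a) S" "inj_on (f b) S"
    "f a ` S \<inter> f b ` S = {}" by blast
  have "f a v \<noteq> f b w" if "v \<in> S" "w \<in> S" for v w
    using S(5) that by blast
  \<comment> \<open>Two edges at the same end \<open>a\<close> or \<open>b\<close> differ by
    injectivity, edges at different ends by disjointness of the images.\<close>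
  then have "inj_on (\<lambda>(u, v). f u v) ({a, b} \<times> S)"
    by (intro inj_onI) (auto dest: inj_onD[OF S(3)] inj_onD[OF S(4)] not_sym)
  moreover have "S \<subseteq> V" "{a, b} \<subseteq> U" "card {a, b} = 2"
    using S(1) ab by (auto simp: D_def)
  ultimately show False using none S(2) by blast
qed

text \<open>No arc runs inside \<open>U\<close> or inside \<open>V\<close>, so inducing on
  \<open>P \<union> S\<close> keeps exactly the arcs between \<open>P\<close> and
  \<open>S\<close>.\<close>

lemma complete_bipartite_induce_subgraph:
  assumes "graph G" and "verts G = U \<union> V" and "U \<inter> V = {}"
    and ends: "arcs_ends G = U \<times> V \<union> V \<times> U"
    and "P \<subseteq> U" and "S \<subseteq> V"
  shows "subgraph (G \<restriction> (P \<union> S)) G"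
    and "complete_bipartite_digraph (card P) (card S) (G \<restriction> (P \<union> S))"
    and "undirected_edges (G \<restriction> (P \<union> S)) = {{u, v} | u v. u \<in> P \<and> v \<in> S}"
proof -
  interpret graph G by fact
  let ?H = "G \<restriction> (P \<union> S)"
  have sub: "P \<union> S \<subseteq> verts G" using assms by auto
  then show "subgraph ?H G" by (intro subgraph_induce_subgraphI)
  have "arcs_ends ?H = {(x, y) \<in> arcs_ends G. x \<in> P \<union> S \<and> y \<in> P \<union> S}"
    by (auto simp: arcs_ends_conv)
  then have ends': "arcs_ends ?H = P \<times> S \<union> S \<times> P"
    using assms by auto
  have "graph ?H"
  proof -
    have ind: "induced_subgraph ?H G" using sub by (rule induced_induce)
    then show ?thesis
      by (intro digraph.graphI digraphI_induced induced_graph_imp_symmetric[OF sym_arcs])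
  qed
  then show "complete_bipartite_digraph (card P) (card S) ?H"
    unfolding complete_bipartite_digraph_def
    using ends' assms by (intro conjI exI[of _ P] exI[of _ S]) auto
  show "undirected_edges ?H = {{u, v} | u v. u \<in> P \<and> v \<in> S}"
    unfolding undirected_edges_def ends' by (auto simp: insert_commute)
qed

theorem theorem3:
  fixes r t n1 n2 :: nat
    and G :: "('a, 'b) pre_digraph"
    and c :: "'a set \<Rightarrow> nat"
  assumes "r \<ge> 1" and "t \<ge> 2"
    and "n1 = (6 * (t - 1) - 1) * r + 2"
    and "n2 = 2 * (t - 1) * ((6 * (t - 1)) choose 2) + 3 * (t - 1) * (r + 1) + 1"
    and "complete_bipartite_digraph n1 n2 G"
    and "c \<in> undirected_edges G \<rightarrow> {1..r}"
  shows "\<exists>H. subgraph H G \<and> complete_bipartite_digraph 2 t H \<and>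
             (monochromatic c H \<or> rainbow c H)"
proof -
  obtain U V where G: "graph G" "verts G = U \<union> V" "U \<inter> V = {}" "arcs_ends G = U \<times> V \<union> V \<times> U"
    and card: "card U = n1" "card V = n2"
    using assms(5) unfolding complete_bipartite_digraph_def by blast
  have range: "c {u, v} \<in> {1..r}" if "u \<in> U" "v \<in> V" for u v
  proof -
    have "{u, v} \<in> undirected_edges G"
      using that unfolding undirected_edges_def G(4) by blast
    then show ?thesis using assms(6) by blast
  qed
  have "finite V" using card(2) assms(4) by (intro card_ge_0_finite) simp
  moreover have "1 \<le> t - 1" using assms(2) by simp
  ultimately obtain P S where PS: "P \<subseteq> U" "S \<subseteq> V" "card P = 2" "card S = t - 1 + 1"
    and col: "(\<exists>j. \<forall>u\<in>P. \<forall>v\<in>S. c {u, v} = j) \<or> inj_on (\<lambda>(u, v). c {u, v}) (P \<times> S)"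
    using monochromatic_or_rainbow_pair[of "t - 1" V U r "\<lambda>u v. c {u, v}"] range card assms(3,4)
    by blast
  note H = complete_bipartite_induce_subgraph[OF G PS(1,2)]
  have "monochromatic c (G \<restriction> (P \<union> S)) \<or> rainbow c (G \<restriction> (P \<union> S))"
    using col
  proof
    assume "\<exists>j. \<forall>u\<in>P. \<forall>v\<in>S. c {u, v} = j"
    then show ?thesis unfolding monochromatic_def H(3) by auto
  next
    assume inj: "inj_on (\<lambda>(u, v). c {u, v}) (P \<times> S)"
    \<comment> \<open>Distinct edges come from distinct pairs in \<open>P \<times> S\<close>, so
      injectivity on pairs suffices.\<close>
    have "rainbow c (G \<restriction> (P \<union> S))"
      unfolding rainbow_def H(3) using inj by (auto simp: inj_on_def)
    then show ?thesis ..
  qed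
  moreover have "card S = t" using PS(4) assms(2) by simp
  ultimately show ?thesis using H(1,2) PS(3) by auto
qed

end
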